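(* Let $G$ be a compact abelian topological group and let $f:G\to G$ be a continuous endomorphism. Then the chain component of the identity $\mathrm{CC}(f)$ is a recurrent subgroup, i.e. the assignment $\mathfrak{R}=\mathrm{CC}$ satisfies properties (R1)--(R4) stated in the context.
   Context: $e$ is the identity of $G$ and $\mathfrak{B}_e$ is a fundamental system of symmetric neighborhoods of $e$ in $G$. For $E\in\mathfrak{B}_e$ and $x,y\in G$, an $E$-chain of $f$ from $x$ to $y$ is a finite sequence $x_0,x_1,\dots,x_n$ in $G$ ($n\ge 1$) with $x_0=x$, $x_n=y$ and $f(x_i)x_{i+1}^{-1}\in E$ for $0\le i\le n-1$. Write $x\rightsquigarrow y$ if for every $E\in\mathfrak{B}_e$ there is an $E$-chain from $x$ to $y$. The chain component of the identity is $\mathrm{CC}(f)=\{x\in G : x\rightsquigarrow e \text{ and } e\rightsquigarrow x\}$. Recurrent subgroup: suppose that a subset $\mathfrak{R}(f)\subseteq G$ is assigned to each continuous endomorphism $f$ of a compact abelian topological group $G$. $\mathfrak{R}(f)$ is called a recurrent subgroup if: (R1) $\mathfrak{R}(f)$ is a subgroup of $G$; (R2) $f(\mathfrak{R}(f))\subseteq \mathfrak{R}(f)$; (R3) $\mathfrak{R}(f)$ is closed in $G$; (R4) $\mathfrak{R}(f)$ is invariant under topological conjugacy: if $f:G\to G$ and $g:H\to H$ are continuous endomorphisms of (compact abelian) topological groups and $\phi:G\to H$ is a continuous group isomorphism with continuous inverse such that $\phi\circ f=g\circ\phi$, then $\mathfrak{R}(g)=\phi(\mathfrak{R}(f))$.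 *)

theory Defs
  imports "HOL-Analysis.Analysis" "HOL-Algebra.Group"
begin

text \<open>A topological group is a group together with an abstract topology whose underlying set is
  the carrier. No separation axiom is imposed.\<close>

locale topological_group = group G for G (structure) and T :: "'a topology" +
  assumes topspace_eq: "topspace T = carrier G"
    and continuous_mult: "continuous_map (prod_topology T T) T (\<lambda>(x, y). x \<otimes> y)"
    and continuous_inv: "continuous_map T T (\<lambda>x. inv x)"

locale compact_abelian_group = topological_group G T + comm_group G
  for G (structure) and T +
  assumes compact: "compact_space T"

definition continuous_endomorphism :: "'a monoid \<Rightarrow> 'a topology \<Rightarrow> ('a \<Rightarrow> 'a) \<Rightarrow> bool" where
  "continuous_endomorphism G T f \<longleftrightarrow> f \<in> hom G G \<and> continuous_map T T f"

text \<open>Neighborhoods of the identity need not be open.\<close>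

definition identity_nbhd :: "'a monoid \<Rightarrow> 'a topology \<Rightarrow> 'a set \<Rightarrow> bool" where
  "identity_nbhd G T E \<longleftrightarrow> E \<subseteq> carrier G \<and> (\<exists>U. openin T U \<and> \<one>\<^bsub>G\<^esub> \<in> U \<and> U \<subseteq> E)"

definition symmetric_nbhd_base :: "'a monoid \<Rightarrow> 'a topology \<Rightarrow> 'a set set \<Rightarrow> bool" where
  "symmetric_nbhd_base G T \<BB> \<longleftrightarrow>
     (\<forall>E\<in>\<BB>. identity_nbhd G T E \<and> (\<lambda>x. inv\<^bsub>G\<^esub> x) ` E = E) \<and>
     (\<forall>V. identity_nbhd G T V \<longrightarrow> (\<exists>E\<in>\<BB>. E \<subseteq> V))"

definition is_chain ::
    "'a monoid \<Rightarrow> ('a \<Rightarrow> 'a) \<Rightarrow> 'a set \<Rightarrow> nat \<Rightarrow> (nat \<Rightarrow> 'a) \<Rightarrow> 'a \<Rightarrow> 'a \<Rightarrow> bool" where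
  "is_chain G f E n c x y \<longleftrightarrow>
     n \<ge> 1 \<and> (\<forall>i\<le>n. c i \<in> carrier G) \<and> c 0 = x \<and> c n = y \<and>
     (\<forall>i<n. f (c i) \<otimes>\<^bsub>G\<^esub> inv\<^bsub>G\<^esub> c (Suc i) \<in> E)"

definition chain_reaches :: "'a monoid \<Rightarrow> 'a set set \<Rightarrow> ('a \<Rightarrow> 'a) \<Rightarrow> 'a \<Rightarrow> 'a \<Rightarrow> bool" where
  "chain_reaches G \<BB> f x y \<longleftrightarrow> (\<forall>E\<in>\<BB>. \<exists>n c. is_chain G f E n c x y)"

definition CC :: "'a monoid \<Rightarrow> 'a set set \<Rightarrow> ('a \<Rightarrow> 'a) \<Rightarrow> 'a set" where
  "CC G \<BB> f =
     {x \<in> carrier G. chain_reaches G \<BB> f x \<one>\<^bsub>G\<^esub> \<and> chain_reaches G \<BB> f \<one>\<^bsub>G\<^esub> x}"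

text \<open>Only the values of an assignment at a compact abelian group \<open>(G, T)\<close> and a continuous
  endomorphism \<open>f\<close> of it are meaningful.\<close>

type_synonym 'a endo_assignment = "'a monoid \<Rightarrow> 'a topology \<Rightarrow> ('a \<Rightarrow> 'a) \<Rightarrow> 'a set"

text \<open>Invariance under conjugacy relates groups with elements of possibly different types.
  A single assignment on all compact abelian groups is therefore represented by its instances
  \<open>R\<close> at type \<open>'a\<close> and \<open>S\<close> at type \<open>'b\<close>.\<close>

definition recurrent_subgroup ::
    "'a endo_assignment \<Rightarrow> 'b endo_assignment \<Rightarrow> 'a monoid \<Rightarrow> 'a topology \<Rightarrow> ('a \<Rightarrow> 'a) \<Rightarrow> bool" where
  "recurrent_subgroup R S G T f \<longleftrightarrow>
     subgroup (R G T f) G \<and>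
     f ` R G T f \<subseteq> R G T f \<and>
     closedin T (R G T f) \<and>
     (\<forall>H U g \<phi>.
        compact_abelian_group H U \<and> continuous_endomorphism H U g \<and>
        \<phi> \<in> iso G H \<and> homeomorphic_map T U \<phi> \<and>
        (\<forall>x\<in>carrier G. \<phi> (f x) = g (\<phi> x)) \<longrightarrow>
        S H U g = \<phi> ` R G T f)"

end

theory Submission
  imports Defs
begin

text \<open>
  Chains are handled as transitive closures: an \<open>E\<close>-chain of positive length is a path of the
  relation \<open>chain_step G f E\<close>, which bounds the error \<open>f x y\<inverse>\<close> of a step \<open>x \<rightarrow> y\<close>. Since the members
  of the base are neighborhoods of the identity, and every such neighborhood contains one of
  them, \<open>x \<leadsto> y\<close> amounts to a relation \<open>chain_related\<close> that mentions only
  the topology (\<open>chain_reaches_iff\<close>). Hence \<open>CC\<close> does not depend on the chosen base, and a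
  conjugacy need not carry the base of one group to that of the other.

  Most of the properties are instances of one functoriality principle
  (\<open>chain_related_hom\<close>): a continuous homomorphism \<open>\<phi>\<close> with \<open>\<phi> \<circ> f = g \<circ> \<phi>\<close> sends a step with
  error in \<open>\<phi>\<inverse>(V)\<close> to a step with error in \<open>V\<close>, and hence preserves chains. Taking \<open>\<phi> = f\<close> gives
  invariance under \<open>f\<close>; taking inversion, which is a homomorphism because \<open>G\<close> is abelian, gives
  closure under inverses; a conjugacy and its inverse give invariance under conjugacy.

  What remains depends on continuity of multiplication at the identity, that is, on a
  neighborhood \<open>W\<close> with \<open>W W \<subseteq> V\<close>. For products of chain component elements, two \<open>W\<close>-chains are
  multiplied term by term; they can be given equal length because \<open>\<one>\<close> is fixed by \<open>f\<close>, so that a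
  chain ending or starting at \<open>\<one>\<close> may wait there. For closedness, an endpoint of a \<open>W\<close>-chain may be
  moved slightly, which spoils only one step, and this by a further factor in \<open>W\<close>.
\<close>

section \<open>Chains as paths of a relation\<close>

definition chain_step :: "'a monoid \<Rightarrow> ('a \<Rightarrow> 'a) \<Rightarrow> 'a set \<Rightarrow> 'a \<Rightarrow> 'a \<Rightarrow> bool" where
  "chain_step G f E x y \<longleftrightarrow>
     x \<in> carrier G \<and> y \<in> carrier G \<and> f x \<otimes>\<^bsub>G\<^esub> inv\<^bsub>G\<^esub> y \<in> E"

definition chain_related ::
    "'a monoid \<Rightarrow> 'a topology \<Rightarrow> ('a \<Rightarrow> 'a) \<Rightarrow> 'a \<Rightarrow> 'a \<Rightarrow> bool" where
  "chain_related G T f x y \<longleftrightarrow> (\<forall>V. identity_nbhd G T V \<longrightarrow> (chain_step G f V)\<^sup>+\<^sup>+ x y)"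

lemma chain_step_mono:
  "chain_step G f E x y \<Longrightarrow> E \<subseteq> F \<Longrightarrow> chain_step G f F x y"
  by (auto simp: chain_step_def)

lemma chain_steps_mono:
  assumes "(chain_step G f E)\<^sup>+\<^sup>+ x y" and "E \<subseteq> F"
  shows "(chain_step G f F)\<^sup>+\<^sup>+ x y"
  using assms(1)
  by (induction rule: tranclp_induct)
    (auto intro: tranclp.r_into_trancl tranclp.trancl_into_trancl chain_step_mono[OF _ assms(2)])

lemma relpowp_refl_point: "P e e \<Longrightarrow> (P ^^ n) e e"
  by (induction n) auto

lemma ex_chain_iff_steps:
  "(\<exists>n c. is_chain G f E n c x y) \<longleftrightarrow> (chain_step G f E)\<^sup>+\<^sup>+ x y"
proof -
  have "is_chain G f E n c x y \<longleftrightarrow>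
      n > 0 \<and> c 0 = x \<and> c n = y \<and> (\<forall>i<n. chain_step G f E (c i) (c (Suc i)))" for n c
  proof
    assume "is_chain G f E n c x y"
    then show "n > 0 \<and> c 0 = x \<and> c n = y \<and> (\<forall>i<n. chain_step G f E (c i) (c (Suc i)))"
      by (auto simp: is_chain_def chain_step_def)
  next
    assume *: "n > 0 \<and> c 0 = x \<and> c n = y \<and> (\<forall>i<n. chain_step G f E (c i) (c (Suc i)))"
    have "c i \<in> carrier G" if "i \<le> n" for i
    proof (cases "i < n")
      case True
      then show ?thesis using * by (auto simp: chain_step_def)
    next
      \<comment> \<open>The last point is the target of the last step, which exists because \<open>n > 0\<close>.\<close>
      case False
      then have "i = Suc (n - 1)" "n - 1 < n" using * that by auto
      then show ?thesis using * unfolding chain_step_def by metis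
    qed
    then show "is_chain G f E n c x y"
      using * by (auto simp: is_chain_def chain_step_def)
  qed
  then show ?thesis
    by (auto simp: tranclp_power relpowp_fun_conv)
qed

lemma chain_reaches_iff:
  assumes "symmetric_nbhd_base G T \<BB>"
  shows "chain_reaches G \<BB> f x y \<longleftrightarrow> chain_related G T f x y"
proof
  assume reach: "chain_reaches G \<BB> f x y"
  show "chain_related G T f x y"
    unfolding chain_related_def
  proof (intro allI impI)
    fix V assume "identity_nbhd G T V"
    then obtain E where "E \<in> \<BB>" "E \<subseteq> V"
      using assms by (auto simp: symmetric_nbhd_base_def)
    from \<open>E \<in> \<BB>\<close> reach have "(chain_step G f E)\<^sup>+\<^sup>+ x y"
      by (simp add: chain_reaches_def ex_chain_iff_steps)
    then show "(chain_step G f V)\<^sup>+\<^sup>+ x y"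
      using \<open>E \<subseteq> V\<close> by (rule chain_steps_mono)
  qed
next
  assume "chain_related G T f x y"
  then show "chain_reaches G \<BB> f x y"
    using assms
    by (simp add: chain_related_def chain_reaches_def ex_chain_iff_steps symmetric_nbhd_base_def)
qed

lemma CC_eq:
  assumes "symmetric_nbhd_base G T \<BB>"
  shows "CC G \<BB> f =
    {x \<in> carrier G. chain_related G T f x \<one>\<^bsub>G\<^esub> \<and> chain_related G T f \<one>\<^bsub>G\<^esub> x}"
  by (simp add: CC_def chain_reaches_iff[OF assms])

section \<open>Functoriality of chains\<close>

text \<open>The error of the image of a step is the image of the error, since
  \<open>g (\<phi> x) (\<phi> y)\<inverse> = \<phi> (f x y\<inverse>)\<close>.\<close>

lemma chain_related_hom:
  assumes "topological_group G T" and "topological_group H U"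
    and hom: "\<phi> \<in> hom G H" and cont: "continuous_map T U \<phi>"
    and f: "f \<in> carrier G \<rightarrow> carrier G"
    and comm: "\<And>x. x \<in> carrier G \<Longrightarrow> \<phi> (f x) = g (\<phi> x)"
    and rel: "chain_related G T f x y"
  shows "chain_related H U g (\<phi> x) (\<phi> y)"
  unfolding chain_related_def
proof (intro allI impI)
  interpret G: topological_group G T by fact
  interpret H: topological_group H U by fact
  interpret group_hom G H \<phi>
    by unfold_locales (rule hom)
  fix V assume "identity_nbhd H U V"
  then obtain O' where O': "openin U O'" "\<one>\<^bsub>H\<^esub> \<in> O'" "O' \<subseteq> V"
    by (auto simp: identity_nbhd_def)
  define W where "W = {x \<in> topspace T. \<phi> x \<in> O'}"
  have "openin T W"
    unfolding W_def using cont O'(1) by (rule openin_continuous_map_preimage)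
  then have "identity_nbhd G T W"
    using O' by (auto simp: identity_nbhd_def W_def G.topspace_eq)
  then have "(chain_step G f W)\<^sup>+\<^sup>+ x y"
    using rel by (simp add: chain_related_def)
  moreover have "chain_step H g V (\<phi> u) (\<phi> v)" if "chain_step G f W u v" for u v
  proof -
    have uv: "u \<in> carrier G" "v \<in> carrier G" "\<phi> (f u \<otimes>\<^bsub>G\<^esub> inv\<^bsub>G\<^esub> v) \<in> V"
      using that O' by (auto simp: chain_step_def W_def)
    moreover have "f u \<in> carrier G" using f uv by auto
    ultimately show ?thesis by (simp add: chain_step_def flip: comm)
  qed
  ultimately show "(chain_step H g V)\<^sup>+\<^sup>+ (\<phi> x) (\<phi> y)"
    by (induction rule: tranclp_induct)
      (auto intro: tranclp.r_into_trancl tranclp.trancl_into_trancl)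
qed

lemma chain_component_hom:
  assumes "topological_group G T" and "topological_group H U"
    and "\<phi> \<in> hom G H" and "continuous_map T U \<phi>"
    and "f \<in> carrier G \<rightarrow> carrier G"
    and "\<And>x. x \<in> carrier G \<Longrightarrow> \<phi> (f x) = g (\<phi> x)"
    and bases: "symmetric_nbhd_base G T \<BB>" "symmetric_nbhd_base H U \<CC>"
    and x: "x \<in> CC G \<BB> f"
  shows "\<phi> x \<in> CC H \<CC> g"
proof -
  interpret G: topological_group G T by fact
  interpret H: topological_group H U by fact
  interpret group_hom G H \<phi>
    by unfold_locales (rule assms(3))
  note rel = chain_related_hom[where \<phi> = \<phi>, OF assms(1-6)]
  show ?thesis
    using x rel[of x "\<one>\<^bsub>G\<^esub>"] rel[of "\<one>\<^bsub>G\<^esub>" x]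
    by (auto simp: CC_eq[OF bases(1)] CC_eq[OF bases(2)])
qed

section \<open>Perturbing and multiplying chains\<close>

locale topological_group_endomorphism = topological_group G T
  for G :: "'a monoid" (structure) and T +
  fixes f :: "'a \<Rightarrow> 'a"
  assumes endo: "continuous_endomorphism G T f"
begin

lemma hom: "f \<in> hom G G" and cont: "continuous_map T T f"
  using endo by (auto simp: continuous_endomorphism_def)

lemma f_carrier: "f \<in> carrier G \<rightarrow> carrier G"
  using hom by (auto simp: hom_def)

lemma identity_nbhd_square_root:
  assumes "identity_nbhd G T V"
  obtains W where "openin T W" "\<one> \<in> W" "W \<subseteq> V" "identity_nbhd G T W"
    "\<And>a b. a \<in> W \<Longrightarrow> b \<in> W \<Longrightarrow> a \<otimes> b \<in> V"
proof -
  obtain Q where Q: "openin T Q" "\<one> \<in> Q" "Q \<subseteq> V"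
    using assms by (auto simp: identity_nbhd_def)
  define P where "P = {z \<in> topspace (prod_topology T T). (\<lambda>(x, y). x \<otimes> y) z \<in> Q}"
  have "openin (prod_topology T T) P"
    unfolding P_def using continuous_mult Q(1) by (rule openin_continuous_map_preimage)
  moreover have "(\<one>, \<one>) \<in> P"
    using Q(2) by (simp add: P_def topspace_eq)
  ultimately have "\<exists>A B. openin T A \<and> openin T B \<and> \<one> \<in> A \<and> \<one> \<in> B \<and> A \<times> B \<subseteq> P"
    unfolding openin_prod_topology_alt by metis
  then obtain A B where AB: "openin T A" "openin T B" "\<one> \<in> A" "\<one> \<in> B" "A \<times> B \<subseteq> P"
    by (elim exE conjE)
  show ?thesis
  proof (rule that[of "A \<inter> B"])
    show op: "openin T (A \<inter> B)" using AB by auto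
    show "\<one> \<in> A \<inter> B" using AB by simp
    show mult: "a \<otimes> b \<in> V" if "a \<in> A \<inter> B" "b \<in> A \<inter> B" for a b
      using that AB(5) Q(3) by (auto simp: P_def)
    have carr: "A \<inter> B \<subseteq> carrier G"
      using openin_subset[OF op] topspace_eq by simp
    show "identity_nbhd G T (A \<inter> B)"
      using op carr AB by (auto simp: identity_nbhd_def)
    show "A \<inter> B \<subseteq> V"
    proof
      fix a assume a: "a \<in> A \<inter> B"
      then have "a \<otimes> \<one> \<in> V" using mult AB by simp
      then show "a \<in> V" using a carr by (auto simp: subset_iff)
    qed
  qed
qed

lemma continuous_mult_fns:
  assumes "continuous_map X T p" and "continuous_map X T q"
  shows "continuous_map X T (\<lambda>z. p z \<otimes> q z)"
proof -
  have "continuous_map X (prod_topology T T) (\<lambda>z. (p z, q z))"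
    using assms by (simp add: continuous_map_pairedI)
  from continuous_map_compose[OF this continuous_mult] show ?thesis
    by (simp add: o_def)
qed

lemma continuous_inv_fn:
  "continuous_map X T p \<Longrightarrow> continuous_map X T (\<lambda>z. inv p z)"
  using continuous_map_compose[OF _ continuous_inv] by (simp add: o_def)

lemma mult_inv_mult_inv:
  assumes "a \<in> carrier G" "b \<in> carrier G" "c \<in> carrier G"
  shows "(a \<otimes> inv b) \<otimes> (b \<otimes> inv c) = a \<otimes> inv c"
proof -
  have "inv b \<otimes> (b \<otimes> inv c) = inv c"
    using assms by (simp flip: m_assoc)
  then show ?thesis using assms by (simp add: m_assoc)
qed

text \<open>If \<open>x'\<close> is so close to \<open>x\<close> that \<open>f x (f x')\<inverse> \<in> W\<close>, the first step \<open>x' \<rightarrow> w\<close> of a \<open>W\<close>-chain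
  becomes a \<open>W W\<close>-step \<open>x \<rightarrow> w\<close>, because \<open>f x w\<inverse> = (f x (f x')\<inverse>) (f x' w\<inverse>)\<close>.\<close>

lemma closedin_chain_sources:
  "closedin T {x \<in> carrier G. chain_related G T f x z}" (is "closedin T ?S")
proof -
  have "x \<in> ?S" if x: "x \<in> T closure_of ?S" for x
  proof -
    have xG: "x \<in> carrier G" using x by (auto simp: in_closure_of topspace_eq)
    have "(chain_step G f V)\<^sup>+\<^sup>+ x z" if "identity_nbhd G T V" for V
      using that
    proof (rule identity_nbhd_square_root)
      fix W
      assume W: "openin T W" "\<one> \<in> W" "W \<subseteq> V" "identity_nbhd G T W"
        "\<And>a b. a \<in> W \<Longrightarrow> b \<in> W \<Longrightarrow> a \<otimes> b \<in> V"
      define N where "N = {x' \<in> topspace T. f x \<otimes> inv f x' \<in> W}"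
      have fx: "f x \<in> carrier G" using f_carrier xG by auto
      have "continuous_map T T (\<lambda>x'. f x \<otimes> inv f x')"
        using fx cont by (intro continuous_mult_fns continuous_inv_fn) (simp_all add: topspace_eq)
      then have "openin T N"
        unfolding N_def using W(1) by (rule openin_continuous_map_preimage)
      moreover have "x \<in> N" using xG W(2) fx by (simp add: N_def topspace_eq)
      ultimately obtain x' where x': "x' \<in> ?S" "x' \<in> N"
        using x by (auto simp: in_closure_of)
      then have "(chain_step G f W)\<^sup>+\<^sup>+ x' z"
        using W(4) by (simp add: chain_related_def)
      then obtain w where w: "chain_step G f W x' w" "(chain_step G f W)\<^sup>*\<^sup>* w z"
        by (auto dest: tranclpD)
      have wG: "w \<in> carrier G" "x' \<in> carrier G" "f x' \<in> carrier G"
        using w f_carrier by (auto simp: chain_step_def)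
      have "(f x \<otimes> inv f x') \<otimes> (f x' \<otimes> inv w) \<in> V"
        using W(5) x'(2) w(1) by (simp add: N_def chain_step_def)
      then have "chain_step G f V x w"
        using xG wG fx by (simp add: chain_step_def mult_inv_mult_inv)
      moreover have "(chain_step G f V)\<^sup>*\<^sup>* w z"
        using w(2) rtranclp_mono chain_step_mono[OF _ W(3)] by (metis predicate2I predicate2D)
      ultimately show ?thesis by (rule rtranclp_into_tranclp2)
    qed
    then show ?thesis using xG by (simp add: chain_related_def)
  qed
  then have "T closure_of ?S \<subseteq> ?S" by (rule subsetI)
  moreover have "?S \<subseteq> topspace T" unfolding topspace_eq by (rule Collect_restrict)
  ultimately show ?thesis by (intro closure_of_subset_eq[THEN iffD1] conjI)
qed

text \<open>Symmetrically, \<open>f w x\<inverse> = (f w x'\<inverse>) (x' x\<inverse>)\<close> when the end point \<open>x'\<close> is moved to \<open>x\<close>.\<close>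

lemma closedin_chain_targets:
  "closedin T {x \<in> carrier G. chain_related G T f z x}" (is "closedin T ?S")
proof -
  have "x \<in> ?S" if x: "x \<in> T closure_of ?S" for x
  proof -
    have xG: "x \<in> carrier G" using x by (auto simp: in_closure_of topspace_eq)
    have "(chain_step G f V)\<^sup>+\<^sup>+ z x" if "identity_nbhd G T V" for V
      using that
    proof (rule identity_nbhd_square_root)
      fix W
      assume W: "openin T W" "\<one> \<in> W" "W \<subseteq> V" "identity_nbhd G T W"
        "\<And>a b. a \<in> W \<Longrightarrow> b \<in> W \<Longrightarrow> a \<otimes> b \<in> V"
      define N where "N = {x' \<in> topspace T. x' \<otimes> inv x \<in> W}"
      have "continuous_map T T (\<lambda>x'. x' \<otimes> inv x)"
        using xG by (intro continuous_mult_fns) (simp_all add: topspace_eq)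
      then have "openin T N"
        unfolding N_def using W(1) by (rule openin_continuous_map_preimage)
      moreover have "x \<in> N" using xG W(2) by (simp add: N_def topspace_eq)
      ultimately obtain x' where x': "x' \<in> ?S" "x' \<in> N"
        using x by (auto simp: in_closure_of)
      then have "(chain_step G f W)\<^sup>+\<^sup>+ z x'"
        using W(4) by (simp add: chain_related_def)
      then obtain w where w: "(chain_step G f W)\<^sup>*\<^sup>* z w" "chain_step G f W w x'"
        by (metis tranclp.cases rtranclp.rtrancl_refl tranclp_into_rtranclp)
      have wG: "w \<in> carrier G" "x' \<in> carrier G" "f w \<in> carrier G"
        using w f_carrier by (auto simp: chain_step_def)
      have "(f w \<otimes> inv x') \<otimes> (x' \<otimes> inv x) \<in> V"
        using W(5) x'(2) w(2) by (simp add: N_def chain_step_def)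
      then have "chain_step G f V w x"
        using xG wG by (simp add: chain_step_def mult_inv_mult_inv)
      moreover have "(chain_step G f V)\<^sup>*\<^sup>* z w"
        using w(1) rtranclp_mono chain_step_mono[OF _ W(3)] by (metis predicate2I predicate2D)
      ultimately show ?thesis by (rule rtranclp_into_tranclp1[rotated])
    qed
    then show ?thesis using xG by (simp add: chain_related_def)
  qed
  then have "T closure_of ?S \<subseteq> ?S" by (rule subsetI)
  moreover have "?S \<subseteq> topspace T" unfolding topspace_eq by (rule Collect_restrict)
  ultimately show ?thesis by (intro closure_of_subset_eq[THEN iffD1] conjI)
qed

lemma chain_step_one:
  assumes "identity_nbhd G T V"
  shows "chain_step G f V \<one> \<one>"
  using assms hom_one[OF hom] by (auto simp: chain_step_def identity_nbhd_def is_group)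

end

locale abelian_group_endomorphism = topological_group_endomorphism G T f + comm_group G
  for G :: "'a monoid" (structure) and T f
begin

text \<open>As \<open>G\<close> is abelian, the error of a product of steps is the product of their errors.\<close>

lemma chain_step_mult:
  assumes W: "\<And>a b. a \<in> W \<Longrightarrow> b \<in> W \<Longrightarrow> a \<otimes> b \<in> V"
    and xu: "chain_step G f W x u" and yv: "chain_step G f W y v"
  shows "chain_step G f V (x \<otimes> y) (u \<otimes> v)"
proof -
  have carr: "x \<in> carrier G" "u \<in> carrier G" "y \<in> carrier G" "v \<in> carrier G"
    "f x \<in> carrier G" "f y \<in> carrier G"
    using xu yv hom by (auto simp: chain_step_def hom_def)
  have "(f x \<otimes> inv u) \<otimes> (f y \<otimes> inv v) \<in> V"
    using W xu yv by (simp add: chain_step_def)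
  also have "(f x \<otimes> inv u) \<otimes> (f y \<otimes> inv v) = f (x \<otimes> y) \<otimes> inv (u \<otimes> v)"
    using carr by (simp add: hom_mult[OF hom] inv_mult m_ac)
  finally show ?thesis using carr by (simp add: chain_step_def)
qed

lemma chain_steps_mult:
  assumes "\<And>a b. a \<in> W \<Longrightarrow> b \<in> W \<Longrightarrow> a \<otimes> b \<in> V"
    and "(chain_step G f W ^^ n) x u" and "(chain_step G f W ^^ n) y v"
  shows "(chain_step G f V ^^ n) (x \<otimes> y) (u \<otimes> v)"
  using assms(2,3)
proof (induction n arbitrary: u v)
  case 0
  then show ?case by simp
next
  case (Suc n)
  then show ?case
    using chain_step_mult[OF assms(1)] by (fastforce intro: relcomppI elim!: relcomppE)
qed

section \<open>The chain component as a subgroup\<close>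

text \<open>Both chains are prolonged to the common length \<open>n + m\<close>: chains towards \<open>\<one>\<close> stay at \<open>\<one>\<close> after
  their end, chains from \<open>\<one>\<close> stay there before their start.\<close>

lemma chain_related_mult_one:
  shows "chain_related G T f x \<one> \<Longrightarrow> chain_related G T f y \<one> \<Longrightarrow>
      chain_related G T f (x \<otimes> y) \<one>"
    and "chain_related G T f \<one> x \<Longrightarrow> chain_related G T f \<one> y \<Longrightarrow>
      chain_related G T f \<one> (x \<otimes> y)"
proof -
  have "(chain_step G f V)\<^sup>+\<^sup>+ (x \<otimes> y) \<one>"
    if rel: "chain_related G T f x \<one>" "chain_related G T f y \<one>"
      and V: "identity_nbhd G T V" for V
    using V
  proof (rule identity_nbhd_square_root)
    fix W
    assume W: "identity_nbhd G T W" "\<And>a b. a \<in> W \<Longrightarrow> b \<in> W \<Longrightarrow> a \<otimes> b \<in> V"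
    let ?P = "chain_step G f W"
    obtain n m where nm: "n > 0" "(?P ^^ n) x \<one>" "(?P ^^ m) y \<one>"
      using rel W(1) unfolding chain_related_def tranclp_power by blast
    have wait: "(?P ^^ k) \<one> \<one>" for k
      using chain_step_one[OF W(1)] by (rule relpowp_refl_point)
    have "(?P ^^ (n + m)) x \<one>" "(?P ^^ (m + n)) y \<one>"
      by (rule relpowp_trans[OF nm(2) wait], rule relpowp_trans[OF nm(3) wait])
    then have "(chain_step G f V ^^ (n + m)) (x \<otimes> y) (\<one> \<otimes> \<one>)"
      by (intro chain_steps_mult[OF W(2)]) (simp_all add: add.commute)
    then show ?thesis
      using nm(1) unfolding tranclp_power by (intro exI[of _ "n + m"]) simp
  qed
  then show "chain_related G T f x \<one> \<Longrightarrow> chain_related G T f y \<one> \<Longrightarrow>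
      chain_related G T f (x \<otimes> y) \<one>"
    by (simp add: chain_related_def[of _ _ _ "x \<otimes> y"])
  have "(chain_step G f V)\<^sup>+\<^sup>+ \<one> (x \<otimes> y)"
    if rel: "chain_related G T f \<one> x" "chain_related G T f \<one> y"
      and V: "identity_nbhd G T V" for V
    using V
  proof (rule identity_nbhd_square_root)
    fix W
    assume W: "identity_nbhd G T W" "\<And>a b. a \<in> W \<Longrightarrow> b \<in> W \<Longrightarrow> a \<otimes> b \<in> V"
    let ?P = "chain_step G f W"
    obtain n m where nm: "n > 0" "(?P ^^ n) \<one> x" "(?P ^^ m) \<one> y"
      using rel W(1) unfolding chain_related_def tranclp_power by blast
    have wait: "(?P ^^ k) \<one> \<one>" for k
      using chain_step_one[OF W(1)] by (rule relpowp_refl_point)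
    have "(?P ^^ (m + n)) \<one> x" "(?P ^^ (n + m)) \<one> y"
      by (rule relpowp_trans[OF wait nm(2)], rule relpowp_trans[OF wait nm(3)])
    then have "(chain_step G f V ^^ (n + m)) (\<one> \<otimes> \<one>) (x \<otimes> y)"
      by (intro chain_steps_mult[OF W(2)]) (simp_all add: add.commute)
    then show ?thesis
      using nm(1) unfolding tranclp_power by (intro exI[of _ "n + m"]) simp
  qed
  then show "chain_related G T f \<one> x \<Longrightarrow> chain_related G T f \<one> y \<Longrightarrow>
      chain_related G T f \<one> (x \<otimes> y)"
    by (simp add: chain_related_def[of _ _ _ _ "x \<otimes> y"])
qed

lemma subgroup_CC:
  assumes base: "symmetric_nbhd_base G T \<BB>"
  shows "subgroup (CC G \<BB> f) G"
proof (rule subgroupI)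
  show "CC G \<BB> f \<subseteq> carrier G" by (auto simp: CC_def)
  have "chain_related G T f \<one> \<one>"
    using chain_step_one by (auto simp: chain_related_def)
  then show "CC G \<BB> f \<noteq> {}" by (auto simp: CC_eq[OF base])
next
  fix x assume x: "x \<in> CC G \<BB> f"
  have inv_hom: "(\<lambda>x. inv x) \<in> hom G G"
    by (auto simp: hom_def inv_mult)
  interpret f: group_hom G G f
    by unfold_locales (rule hom)
  show "inv x \<in> CC G \<BB> f"
    using chain_component_hom[OF topological_group_axioms topological_group_axioms inv_hom
        continuous_inv f_carrier _ base base x, of f]
    by simp
next
  fix x y assume "x \<in> CC G \<BB> f" "y \<in> CC G \<BB> f"
  then show "x \<otimes> y \<in> CC G \<BB> f"
    by (simp add: CC_eq[OF base] chain_related_mult_one)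
qed

lemma closedin_CC:
  assumes base: "symmetric_nbhd_base G T \<BB>"
  shows "closedin T (CC G \<BB> f)"
proof -
  have "CC G \<BB> f = {x \<in> carrier G. chain_related G T f x \<one>} \<inter>
      {x \<in> carrier G. chain_related G T f \<one> x}"
    by (auto simp: CC_eq[OF base])
  then show ?thesis
    by (simp only: closedin_Int closedin_chain_sources closedin_chain_targets)
qed

end

section \<open>Invariance under conjugacy\<close>

text \<open>A conjugacy and its inverse both map chain components into chain components.\<close>

lemma CC_conjugacy:
  assumes G: "topological_group G T" and H: "topological_group H U"
    and f: "f \<in> carrier G \<rightarrow> carrier G" and g: "g \<in> carrier H \<rightarrow> carrier H"
    and iso: "\<phi> \<in> iso G H" and homeo: "homeomorphic_map T U \<phi>"
    and comm: "\<And>x. x \<in> carrier G \<Longrightarrow> \<phi> (f x) = g (\<phi> x)"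
    and bases: "symmetric_nbhd_base G T \<BB>" "symmetric_nbhd_base H U \<CC>"
  shows "CC H \<CC> g = \<phi> ` CC G \<BB> f"
proof
  interpret G: topological_group G T by fact
  interpret H: topological_group H U by fact
  have hom: "\<phi> \<in> hom G H" and bij: "bij_betw \<phi> (carrier G) (carrier H)"
    using iso by (auto simp: iso_def)
  show "\<phi> ` CC G \<BB> f \<subseteq> CC H \<CC> g"
    using chain_component_hom[OF G H hom homeomorphic_imp_continuous_map[OF homeo] f comm bases]
    by auto
  define \<psi> where "\<psi> = inv_into (carrier G) \<phi>"
  have \<psi>: "\<psi> (\<phi> x) = x" if "x \<in> carrier G" for x
    using that bij by (simp add: \<psi>_def bij_betw_inv_into_left)
  have \<psi>': "\<phi> (\<psi> y) = y" "\<psi> y \<in> carrier G" if "y \<in> carrier H" for y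
    using that bij bij_betw_inv_into[OF bij]
    by (auto simp: \<psi>_def bij_betw_inv_into_right dest: bij_betwE)
  have hom': "\<psi> \<in> hom H G"
    using G.iso_set_sym[OF iso] by (simp add: \<psi>_def iso_def)
  obtain k where k: "homeomorphic_maps T U \<phi> k"
    using homeo by (auto simp: homeomorphic_map_maps)
  have "k y = \<psi> y" if "y \<in> topspace U" for y
    using that k \<psi> \<psi>'
    by (auto simp: homeomorphic_maps_def G.topspace_eq H.topspace_eq) (metis \<psi>')
  then have cont': "continuous_map U T \<psi>"
    using k by (auto simp: homeomorphic_maps_def intro: continuous_map_eq)
  have comm': "\<psi> (g y) = f (\<psi> y)" if "y \<in> carrier H" for y
    using comm[of "\<psi> y"] \<psi>[of "f (\<psi> y)"] \<psi>'[OF that] f by auto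
  show "CC H \<CC> g \<subseteq> \<phi> ` CC G \<BB> f"
  proof
    fix y assume y: "y \<in> CC H \<CC> g"
    then have "\<psi> y \<in> CC G \<BB> f"
      using chain_component_hom[OF H G hom' cont' g comm' bases(2,1)] by blast
    moreover have "\<phi> (\<psi> y) = y" using y \<psi>' by (auto simp: CC_def)
    ultimately show "y \<in> \<phi> ` CC G \<BB> f" by (metis imageI)
  qed
qed

theorem proposition2p4:
  fixes G :: "'a monoid" and T :: "'a topology" and f :: "'a \<Rightarrow> 'a"
    and \<BB> :: "'a monoid \<Rightarrow> 'a topology \<Rightarrow> 'a set set"
    and \<BB>' :: "'b monoid \<Rightarrow> 'b topology \<Rightarrow> 'b set set"
  assumes "\<And>K V. compact_abelian_group K V \<Longrightarrow> symmetric_nbhd_base K V (\<BB> K V)"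
    and "\<And>K V. compact_abelian_group K V \<Longrightarrow> symmetric_nbhd_base K V (\<BB>' K V)"
    and "compact_abelian_group G T"
    and "continuous_endomorphism G T f"
  shows "recurrent_subgroup (\<lambda>K V. CC K (\<BB> K V)) (\<lambda>K V. CC K (\<BB>' K V)) G T f"
proof -
  interpret C: compact_abelian_group G T by fact
  interpret G: abelian_group_endomorphism G T f
    by unfold_locales fact
  note base = assms(1)[OF assms(3)]
  have "f ` CC G (\<BB> G T) f \<subseteq> CC G (\<BB> G T) f"
    using chain_component_hom[OF C.topological_group_axioms C.topological_group_axioms
        G.hom G.cont G.f_carrier refl base base] by blast
  moreover have "CC H (\<BB>' H U) g = \<phi> ` CC G (\<BB> G T) f"
    if H: "compact_abelian_group H U" and g: "continuous_endomorphism H U g"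
      and \<phi>: "\<phi> \<in> iso G H" "homeomorphic_map T U \<phi>"
        "\<forall>x\<in>carrier G. \<phi> (f x) = g (\<phi> x)" for H U g \<phi>
  proof -
    interpret H: compact_abelian_group H U by fact
    have "g \<in> carrier H \<rightarrow> carrier H"
      using g by (auto simp: continuous_endomorphism_def hom_def)
    then show ?thesis
      using \<phi> by (intro CC_conjugacy[OF C.topological_group_axioms H.topological_group_axioms
            G.f_carrier _ _ _ _ base assms(2)[OF H]]) auto
  qed
  ultimately show ?thesis
    unfolding recurrent_subgroup_def
    using G.subgroup_CC[OF base] G.closedin_CC[OF base] by blast
qed

end
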